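(* Let $e\in\mathbb{R}$, $\vec\mu\in\mathbb{R}^3$, $c>0$. For $a,\epsilon\in\,]0,1[$ let $\vec E$, $\vec H$, $\varrho$, $\vec j$ be the Colombeau-regularized fields, charge density and current density of the pole-dipole singularity at the origin, defined in the context. Then for all $a,\epsilon\in\,]0,1[$ the total self-force vanishes: $$\int_{\mathbb{R}^3}\big(\varrho\,\vec E+\vec j\times\vec H\big)\,d^3r=0 .$$
   Context: Mollifier: $\eta\in\mathcal{S}(\mathbb{R})$ is a fixed real-valued even Schwartz function with $\int_{\mathbb{R}}\eta(z)\,dz=1$ and $\int_{\mathbb{R}}z^n\eta(z)\,dz=0$ for all integers $n\ge1$. A distribution $f$ on $\mathbb{R}$ is regularized as $f_\epsilon(x)=\int_{\mathbb{R}}\frac1\epsilon\,\eta\big(\frac{y-x}{\epsilon}\big)f(y)\,dy$ (with the usual distributional meaning). Regularized functions: $\vec r\in\mathbb{R}^3$, $r=|\vec r\,|\ge0$, $\vec u=\vec r/r$, $\mathrm{H}$ is the Heaviside function, $\delta$ the Dirac distribution. For $n\ge1$, $\Upsilon_n,\Upsilon'_n,\Upsilon''_n$ (depending on $a,\epsilon$) denote the regularizations, evaluated at $r$, of the distributions $y\mapsto y^{-n}\mathrm{H}(y-a)$, $y^{-n}\delta(y-a)$, $y^{-n}\delta'(y-a)$, that is, $$\Upsilon_n(r)=\int_{(a-r)/\epsilon}^{\infty}\frac{\eta(z)}{(r+\epsilon z)^n}\,dz,\qquad \Upsilon'_n(r)=\frac{1}{a^n\epsilon}\,\eta\Big(\frac{a-r}{\epsilon}\Big),$$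 $$\Upsilon''_n(r)=-\frac{1}{a^n\epsilon^2}\,\eta'\Big(\frac{a-r}{\epsilon}\Big)+\frac{n}{a^{n+1}\epsilon}\,\eta\Big(\frac{a-r}{\epsilon}\Big).$$ Fields and sources (in the formal notation $\Upsilon_n=r^{-n}\Upsilon$, $\Upsilon_n'=r^{-n}\Upsilon'$, $\Upsilon_n''=r^{-n}\Upsilon''$ one has $\vec E=-\vec\nabla(e\,r^{-1}\Upsilon)$, $\vec H=\vec\nabla\times(\frac{\vec\mu\times\vec r}{r^3}\Upsilon)$, $4\pi\varrho=\vec\nabla\cdot\vec E$, $\frac{4\pi}{c}\vec j=\vec\nabla\times\vec H$): $$\vec E=e\big[\Upsilon_2-\Upsilon'_1\big]\vec u,\qquad \vec H=\big[3\vec u(\vec\mu\cdot\vec u)-\vec\mu\big]\Upsilon_3-\big[\vec u(\vec\mu\cdot\vec u)-\vec\mu\big]\Upsilon'_2,$$ $$\varrho=-\frac{e}{4\pi}\Upsilon''_1,\qquad \vec j=\frac{c}{4\pi}\big[2\Upsilon'_3-\Upsilon''_2\big]\,\vec\mu\times\vec u .$$ *)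

theory Defs
  imports "HOL-Analysis.Analysis"
begin

definition schwartz :: "(real \<Rightarrow> real) \<Rightarrow> bool" where
  "schwartz f \<longleftrightarrow>
     (\<forall>k x. (deriv ^^ k) f differentiable (at x)) \<and>
     (\<forall>k m. bounded (range (\<lambda>x. x ^ m * (deriv ^^ k) f x)))"

definition mollifier :: "(real \<Rightarrow> real) \<Rightarrow> bool" where
  "mollifier \<eta> \<longleftrightarrow>
     schwartz \<eta> \<and>
     (\<forall>z. \<eta> (- z) = \<eta> z) \<and>
     (LBINT z. \<eta> z) = 1 \<and>
     (\<forall>n\<ge>1. (LBINT z. z ^ n * \<eta> z) = 0)"

text \<open>Distributions on the line are represented by their action on test functions.\<close>

definition regularize ::
    "(real \<Rightarrow> real) \<Rightarrow> real \<Rightarrow> ((real \<Rightarrow> real) \<Rightarrow> real) \<Rightarrow> real \<Rightarrow> real" where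
  "regularize \<eta> \<epsilon> T x = T (\<lambda>y. \<eta> ((y - x) / \<epsilon>) / \<epsilon>)"

definition Ups :: "(real \<Rightarrow> real) \<Rightarrow> real \<Rightarrow> real \<Rightarrow> nat \<Rightarrow> real \<Rightarrow> real" where
  "Ups \<eta> a \<epsilon> n r = (LBINT z:{(a - r) / \<epsilon>..}. \<eta> z / (r + \<epsilon> * z) ^ n)"

definition Ups' :: "(real \<Rightarrow> real) \<Rightarrow> real \<Rightarrow> real \<Rightarrow> nat \<Rightarrow> real \<Rightarrow> real" where
  "Ups' \<eta> a \<epsilon> n r = 1 / (a ^ n * \<epsilon>) * \<eta> ((a - r) / \<epsilon>)"

definition Ups'' :: "(real \<Rightarrow> real) \<Rightarrow> real \<Rightarrow> real \<Rightarrow> nat \<Rightarrow> real \<Rightarrow> real" where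
  "Ups'' \<eta> a \<epsilon> n r =
     - (1 / (a ^ n * \<epsilon>\<^sup>2)) * deriv \<eta> ((a - r) / \<epsilon>)
     + real n / (a ^ (n + 1) * \<epsilon>) * \<eta> ((a - r) / \<epsilon>)"

text \<open>These are the regularizations of the distributions \<open>y\<^sup>-\<^sup>n H(y - a)\<close>,
  \<open>y\<^sup>-\<^sup>n \<delta>(y - a)\<close> and \<open>y\<^sup>-\<^sup>n \<delta>'(y - a)\<close>.\<close>

lemma Ups_eq_regularize:
  assumes "\<epsilon> > 0"
  shows "Ups \<eta> a \<epsilon> n r = regularize \<eta> \<epsilon> (\<lambda>\<phi>. LBINT y:{a..}. \<phi> y / y ^ n) r"
proof -
  have "(LBINT y. indicat_real {a..} y *\<^sub>R (\<eta> ((y - r) / \<epsilon>) / \<epsilon> / y ^ n)) =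
      \<epsilon> * (LBINT z. indicat_real {a..} (r + \<epsilon> * z) *\<^sub>R
                      (\<eta> ((r + \<epsilon> * z - r) / \<epsilon>) / \<epsilon> / (r + \<epsilon> * z) ^ n))"
    using assms by (subst lborel_integral_real_affine[of \<epsilon> _ r]) auto
  also have "\<dots> = (LBINT z. \<epsilon> * (indicat_real {a..} (r + \<epsilon> * z) *\<^sub>R
                      (\<eta> ((r + \<epsilon> * z - r) / \<epsilon>) / \<epsilon> / (r + \<epsilon> * z) ^ n)))"
    by (rule integral_mult_right_zero [symmetric])
  also have "\<dots> = (LBINT z. indicat_real {(a - r) / \<epsilon>..} z *\<^sub>R (\<eta> z / (r + \<epsilon> * z) ^ n))"
    using assms
    by (intro Bochner_Integration.integral_cong)
       (auto simp: indicator_def divide_le_eq mult.commute algebra_simps)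
  finally show ?thesis
    by (simp add: Ups_def regularize_def set_lebesgue_integral_def)
qed

lemma Ups'_eq_regularize:
  "Ups' \<eta> a \<epsilon> n r = regularize \<eta> \<epsilon> (\<lambda>\<phi>. \<phi> a / a ^ n) r"
  by (simp add: Ups'_def regularize_def)

lemma Ups''_eq_regularize:
  assumes "schwartz \<eta>" "a > 0" "\<epsilon> > 0"
  shows "Ups'' \<eta> a \<epsilon> n r = regularize \<eta> \<epsilon> (\<lambda>\<phi>. - deriv (\<lambda>y. \<phi> y / y ^ n) a) r"
proof -
  have "\<eta> differentiable (at x)" for x
    using assms(1) unfolding schwartz_def by (metis funpow_0)
  then have D: "(\<eta> has_real_derivative deriv \<eta> x) (at x)" for x
    by (simp add: DERIV_deriv_iff_real_differentiable)
  have "((\<lambda>y. \<eta> ((y - r) / \<epsilon>) / \<epsilon> / y ^ n) has_real_derivative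
      (deriv \<eta> ((a - r) / \<epsilon>) * (1 / \<epsilon>) / \<epsilon> * a ^ n
        - \<eta> ((a - r) / \<epsilon>) / \<epsilon> * (real n * a ^ (n - 1))) / (a ^ n * a ^ n)) (at a)"
    using assms(2,3) by (auto intro!: derivative_eq_intros DERIV_chain2[OF D] simp: field_simps)
  then have "deriv (\<lambda>y. \<eta> ((y - r) / \<epsilon>) / \<epsilon> / y ^ n) a =
      (deriv \<eta> ((a - r) / \<epsilon>) * (1 / \<epsilon>) / \<epsilon> * a ^ n
        - \<eta> ((a - r) / \<epsilon>) / \<epsilon> * (real n * a ^ (n - 1))) / (a ^ n * a ^ n)"
    by (rule DERIV_imp_deriv)
  also have "\<dots> = - Ups'' \<eta> a \<epsilon> n r"
    using assms(2,3)
    by (cases n) (simp_all add: Ups''_def field_simps power2_eq_square)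
  finally show ?thesis
    by (simp add: regularize_def)
qed

text \<open>At the origin \<open>unit_vec\<close> takes the value \<open>0\<close>; a null set for the force integral.\<close>

definition unit_vec :: "real ^ 3 \<Rightarrow> real ^ 3" where
  "unit_vec r = r /\<^sub>R norm r"

definition E_field ::
    "(real \<Rightarrow> real) \<Rightarrow> real \<Rightarrow> real \<Rightarrow> real \<Rightarrow> real ^ 3 \<Rightarrow> real ^ 3" where
  "E_field \<eta> a \<epsilon> e r =
     (e * (Ups \<eta> a \<epsilon> 2 (norm r) - Ups' \<eta> a \<epsilon> 1 (norm r))) *\<^sub>R unit_vec r"

definition H_field ::
    "(real \<Rightarrow> real) \<Rightarrow> real \<Rightarrow> real \<Rightarrow> real ^ 3 \<Rightarrow> real ^ 3 \<Rightarrow> real ^ 3" where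
  "H_field \<eta> a \<epsilon> \<mu> r =
     Ups \<eta> a \<epsilon> 3 (norm r) *\<^sub>R ((3 * (\<mu> \<bullet> unit_vec r)) *\<^sub>R unit_vec r - \<mu>)
     - Ups' \<eta> a \<epsilon> 2 (norm r) *\<^sub>R ((\<mu> \<bullet> unit_vec r) *\<^sub>R unit_vec r - \<mu>)"

definition charge_density ::
    "(real \<Rightarrow> real) \<Rightarrow> real \<Rightarrow> real \<Rightarrow> real \<Rightarrow> real ^ 3 \<Rightarrow> real" where
  "charge_density \<eta> a \<epsilon> e r = - (e / (4 * pi)) * Ups'' \<eta> a \<epsilon> 1 (norm r)"

definition current_density ::
    "(real \<Rightarrow> real) \<Rightarrow> real \<Rightarrow> real \<Rightarrow> real \<Rightarrow> real ^ 3 \<Rightarrow> real ^ 3 \<Rightarrow> real ^ 3" where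
  "current_density \<eta> a \<epsilon> c \<mu> r =
     (c / (4 * pi) * (2 * Ups' \<eta> a \<epsilon> 3 (norm r) - Ups'' \<eta> a \<epsilon> 2 (norm r)))
       *\<^sub>R cross3 \<mu> (unit_vec r)"

end

(*
  The unit vector is odd in r while all radial coefficients are even, so rho and H are even, E and j
  are odd, and the force density is odd; its integral vanishes as soon as it converges. Convergence:
  rho and j are built from eta and eta' evaluated at (a - r) / epsilon, hence decay faster than any
  power of r, and E and H are bounded because the denominators in Ups stay above a ^ n on the domain
  of integration.
*)
theory Submission
  imports Defs "HOL-Probability.Sinc_Integral"
begin

section \<open>Integration on Euclidean space: polynomial decay and odd functions\<close>

lemma integrable_inverse_1_plus_square_lborel:
  "integrable lborel (\<lambda>x::real. inverse (1 + x\<^sup>2))"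
  using integrable_inverse_1_plus_square by (simp add: set_integrable_def)

text \<open>Fubini in coordinates: \<open>lborel\<close> is the image of the product of
  one-dimensional Lebesgue measures under the map that assembles a vector from its
  coordinates.\<close>

lemma integrable_lborel_prod_Basis:
  fixes f :: "'a::euclidean_space \<Rightarrow> real \<Rightarrow> real"
  assumes "\<And>b. b \<in> Basis \<Longrightarrow> integrable lborel (f b)"
  shows "integrable lborel (\<lambda>x::'a. \<Prod>b\<in>Basis. f b (x \<bullet> b))"
proof -
  interpret product_sigma_finite "\<lambda>_::'a. lborel :: real measure" ..
  have m [measurable]: "f b \<in> borel_measurable borel" if "b \<in> Basis" for b
    using borel_measurable_integrable[OF assms[OF that]] by simp
  have "integrable (\<Pi>\<^sub>M b\<in>Basis. lborel) (\<lambda>x. \<Prod>b\<in>Basis. f b (x b))"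
    using assms by (intro product_integrable_prod) auto
  then show ?thesis
    by (subst lborel_eq, subst integrable_distr_eq)
       (auto intro!: borel_measurable_prod measurable_compose[OF _ m]
         simp: inner_sum_left inner_Basis if_distrib cong: if_cong prod.cong)
qed

text \<open>The exponent \<open>DIM('a)\<close> provides one factor per coordinate. Each coordinate
  is at most the norm in absolute value, so the function is dominated by a product of
  one-dimensional functions \<open>inverse (1 + t\<^sup>2)\<close>, which is integrable.\<close>

lemma integrable_lborel_norm_decay:
  "integrable lborel (\<lambda>x::'a::euclidean_space. 1 / (1 + (norm x)\<^sup>2) ^ DIM('a))"
proof (rule Bochner_Integration.integrable_bound)
  show "integrable lborel (\<lambda>x::'a. \<Prod>b\<in>Basis. inverse (1 + (x \<bullet> b)\<^sup>2))"
    by (rule integrable_lborel_prod_Basis) (rule integrable_inverse_1_plus_square_lborel)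
  have "1 / (1 + (norm x)\<^sup>2) ^ DIM('a) \<le> (\<Prod>b\<in>Basis. inverse (1 + (x \<bullet> b)\<^sup>2))" for x :: 'a
  proof -
    have "(\<Prod>b\<in>(Basis::'a set). 1 + (x \<bullet> b)\<^sup>2) \<le> (\<Prod>b\<in>(Basis::'a set). 1 + (norm x)\<^sup>2)"
      by (intro prod_mono) (auto simp: Basis_le_norm abs_le_square_iff[symmetric])
    moreover have "0 < (\<Prod>b\<in>(Basis::'a set). 1 + (x \<bullet> b)\<^sup>2)"
      by (intro prod_pos) (simp add: add_pos_nonneg)
    ultimately have "inverse ((1 + (norm x)\<^sup>2) ^ DIM('a)) \<le> inverse (\<Prod>b\<in>Basis. 1 + (x \<bullet> b)\<^sup>2)"
      by (intro le_imp_inverse_le) auto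
    then show ?thesis
      by (simp add: prod_inversef[symmetric] divide_inverse o_def)
  qed
  moreover have "0 \<le> 1 / (1 + (norm x)\<^sup>2) ^ DIM('a)" for x :: 'a
    by simp
  ultimately show "AE x::'a in lborel. norm (1 / (1 + (norm x)\<^sup>2) ^ DIM('a))
      \<le> norm (\<Prod>b\<in>Basis. inverse (1 + (x \<bullet> b)\<^sup>2))"
    by (intro AE_I2) (metis abs_of_nonneg order_trans real_norm_def)
qed simp

text \<open>Reflection in the origin preserves \<open>lborel\<close>, so the integral equals its own
  negative. A non-integrable \<open>f\<close> is covered too, because its Bochner integral is 0 by
  convention; hence convergence has to be shown separately.\<close>

lemma lborel_integral_odd_eq_0:
  fixes f :: "'a::euclidean_space \<Rightarrow> 'b::{banach, second_countable_topology}"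
  assumes m: "f \<in> borel_measurable borel" and odd: "\<And>x. f (- x) = - f x"
  shows "(LBINT x. f x) = 0"
proof -
  \<comment> \<open>The reflection is written as an affine map of factor -1, whose Jacobian has
    absolute value 1.\<close>
  have "(LBINT x. f x) = integral\<^sup>L (distr lborel borel (\<lambda>x. 0 + (-1) *\<^sub>R x)) f"
    by (subst lborel_affine[of "-1" 0]) (simp_all add: density_1)
  also have "\<dots> = - (LBINT x. f x)"
    using m by (subst integral_distr) (auto simp: odd)
  finally have "2 *\<^sub>R (LBINT x. f x) = 0"
    by (metis scaleR_2 add.left_inverse)
  then show ?thesis
    by simp
qed

text \<open>Lagrange's identity: the two squares differ by the square of
  \<open>x \<bullet> y\<close>.\<close>

lemma norm_cross3_le: "norm (cross3 x y) \<le> norm x * norm y"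
proof (rule power2_le_imp_le)
  show "(norm (cross3 x y))\<^sup>2 \<le> (norm x * norm y)\<^sup>2"
    by (simp add: norm_cross power_mult_distrib)
qed simp

section \<open>Regularity and decay of Schwartz functions and their derivatives\<close>

lemma schwartz_DERIV:
  assumes "schwartz f"
  shows "(f has_real_derivative deriv f x) (at x)"
    and "(deriv f has_real_derivative deriv (deriv f) x) (at x)"
proof -
  have "(deriv ^^ 0) f differentiable (at x)" "(deriv ^^ 1) f differentiable (at x)"
    using assms unfolding schwartz_def by blast+
  then show "(f has_real_derivative deriv f x) (at x)" "(deriv f has_real_derivative deriv (deriv f) x) (at x)"
    by (simp_all add: DERIV_deriv_iff_real_differentiable)
qed

text \<open>Passing from \<open>n\<close> to \<open>n + 1\<close> splits the \<open>m\<close>-th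
  moment into the \<open>m\<close>-th and the \<open>(m + 2)\<close>-nd moment for \<open>n\<close>.
  The induction therefore runs over all \<open>m\<close> at once, and only \<open>m = 0\<close> is
  read off at the end.\<close>

lemma bounded_moments_decay:
  fixes g :: "real \<Rightarrow> real"
  assumes "\<And>m. bounded (range (\<lambda>x. x ^ m * g x))"
  obtains C where "\<And>x. \<bar>g x\<bar> * (1 + x\<^sup>2) ^ n \<le> C"
proof -
  have "bounded (range (\<lambda>x. x ^ m * (g x * (1 + x\<^sup>2) ^ n)))" for m
  proof (induction n arbitrary: m)
    case 0
    then show ?case using assms by simp
  next
    case (Suc n)
    have "bounded (range (\<lambda>x. x ^ m * (g x * (1 + x\<^sup>2) ^ n) + x ^ (m + 2) * (g x * (1 + x\<^sup>2) ^ n)))"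
      by (intro bounded_plus_comp Suc)
    then show ?case by (simp add: algebra_simps power2_eq_square)
  qed
  from this[of 0] obtain C where "\<And>x. norm (g x * (1 + x\<^sup>2) ^ n) \<le> C"
    by (auto simp: bounded_iff)
  then show ?thesis
    by (intro that[of C]) (simp add: abs_mult)
qed

text \<open>Transfers decay in the scaled variable to decay in the radius: the two weights are
  comparable up to the factor \<open>K\<close>, which costs \<open>K ^ n\<close> in the
  constant.\<close>

lemma bounded_moments_decay_affine:
  fixes g :: "real \<Rightarrow> real"
  assumes "\<And>m. bounded (range (\<lambda>x. x ^ m * g x))" and "\<epsilon> \<noteq> 0"
  obtains C where "\<And>t. \<bar>g ((a - t) / \<epsilon>)\<bar> \<le> C / (1 + t\<^sup>2) ^ n"
proof -
  obtain C where C: "\<And>x. \<bar>g x\<bar> * (1 + x\<^sup>2) ^ n \<le> C"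
    using bounded_moments_decay[OF assms(1)] by blast
  define K where "K = 1 + 2 * a\<^sup>2 + 2 * \<epsilon>\<^sup>2"
  have K: "1 + t\<^sup>2 \<le> K * (1 + ((a - t) / \<epsilon>)\<^sup>2)" for t
  proof -
    define s where "s = (a - t) / \<epsilon>"
    have t: "t = a - \<epsilon> * s" using assms(2) by (simp add: s_def)
    have "t\<^sup>2 \<le> 2 * a\<^sup>2 + 2 * \<epsilon>\<^sup>2 * s\<^sup>2"
      \<comment> \<open>The right side minus the left side is exactly the square of
        \<open>a + \<epsilon> * s\<close>.\<close>
      using zero_le_power2[of "a + \<epsilon> * s"] unfolding t by (simp add: power2_eq_square algebra_simps)
    also have "1 + \<dots> \<le> K * (1 + s\<^sup>2)"
      unfolding K_def by (simp add: algebra_simps)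
    finally show ?thesis by (simp add: s_def)
  qed
  have "\<bar>g ((a - t) / \<epsilon>)\<bar> \<le> K ^ n * C / (1 + t\<^sup>2) ^ n" for t
  proof -
    have "\<bar>g ((a - t) / \<epsilon>)\<bar> * (1 + t\<^sup>2) ^ n \<le> \<bar>g ((a - t) / \<epsilon>)\<bar> * (K * (1 + ((a - t) / \<epsilon>)\<^sup>2)) ^ n"
      by (intro mult_left_mono power_mono K) auto
    also have "\<dots> = K ^ n * (\<bar>g ((a - t) / \<epsilon>)\<bar> * (1 + ((a - t) / \<epsilon>)\<^sup>2) ^ n)"
      by (simp add: power_mult_distrib)
    also have "\<dots> \<le> K ^ n * C"
      by (intro mult_left_mono C) (simp add: K_def)
    finally show ?thesis
      by (simp add: pos_le_divide_eq add_pos_nonneg)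
  qed
  then show ?thesis by (rule that)
qed

lemma schwartz_moments:
  assumes "schwartz f"
  shows "bounded (range (\<lambda>x. x ^ m * f x))" "bounded (range (\<lambda>x. x ^ m * deriv f x))"
proof -
  have "bounded (range (\<lambda>x. x ^ m * (deriv ^^ 0) f x))" "bounded (range (\<lambda>x. x ^ m * (deriv ^^ 1) f x))"
    using assms unfolding schwartz_def by blast+
  then show "bounded (range (\<lambda>x. x ^ m * f x))" "bounded (range (\<lambda>x. x ^ m * deriv f x))"
    by simp_all
qed

lemma schwartz_borel_measurable:
  assumes "schwartz f"
  shows "f \<in> borel_measurable borel" "deriv f \<in> borel_measurable borel"
  using schwartz_DERIV[OF assms]
  by (auto intro!: borel_measurable_continuous_onI DERIV_isCont simp: continuous_on_eq_continuous_at)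

lemma schwartz_integrable:
  assumes "schwartz f"
  shows "integrable lborel f"
proof -
  obtain C where C: "\<And>x. \<bar>f x\<bar> * (1 + x\<^sup>2) ^ 1 \<le> C"
    using bounded_moments_decay schwartz_moments(1)[OF assms] by blast
  show ?thesis
  proof (rule Bochner_Integration.integrable_bound)
    show "integrable lborel (\<lambda>x. C * inverse (1 + x\<^sup>2))"
      by (intro integrable_mult_right integrable_inverse_1_plus_square_lborel)
    show "AE x in lborel. norm (f x) \<le> norm (C * inverse (1 + x\<^sup>2))"
    proof (intro AE_I2)
      fix x
      have "\<bar>f x\<bar> \<le> C * inverse (1 + x\<^sup>2)"
        using C[of x] by (simp add: divide_inverse[symmetric] pos_le_divide_eq add_pos_nonneg)
      then show "norm (f x) \<le> norm (C * inverse (1 + x\<^sup>2))"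
        by simp
    qed
  qed (simp add: schwartz_borel_measurable[OF assms])
qed

section \<open>Bounds and measurability of the regularized functions\<close>

lemma abs_Ups_le:
  assumes "schwartz \<eta>" "a > 0" "\<epsilon> > 0"
  shows "\<bar>Ups \<eta> a \<epsilon> n r\<bar> \<le> (LBINT z. \<bar>\<eta> z\<bar>) / a ^ n"
proof -
  have "\<bar>Ups \<eta> a \<epsilon> n r\<bar> \<le> (LBINT z. \<bar>\<eta> z\<bar> / a ^ n)"
    unfolding Ups_def set_lebesgue_integral_def real_norm_def[symmetric]
  proof (rule Bochner_Integration.integral_norm_bound_integral)
    show "integrable lborel (\<lambda>z. norm (\<eta> z) / a ^ n)"
      using schwartz_integrable[OF assms(1)] by simp
    \<comment> \<open>The cut-off forces \<open>r + \<epsilon> * z \<ge> a\<close>, which makes the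
      bound uniform in \<open>r\<close>. It is used twice: for the inequality between the integrals
      and for integrability by domination.\<close>
    have bound: "norm (indicat_real {(a - r) / \<epsilon>..} z *\<^sub>R (\<eta> z / (r + \<epsilon> * z) ^ n)) \<le> norm (\<eta> z) / a ^ n" for z
    proof (cases "(a - r) / \<epsilon> \<le> z")
      case True
      then have "a \<le> r + \<epsilon> * z"
        using assms by (simp add: field_simps)
      then have "a ^ n \<le> (r + \<epsilon> * z) ^ n"
        using assms by (intro power_mono) auto
      then show ?thesis
        using True assms \<open>a \<le> r + \<epsilon> * z\<close> by (auto simp: abs_mult power_abs intro!: divide_left_mono)
    qed (use assms in auto)
    then show "norm (indicat_real {(a - r) / \<epsilon>..} z *\<^sub>R (\<eta> z / (r + \<epsilon> * z) ^ n)) \<le> norm (\<eta> z) / a ^ n" for z .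
    note [measurable] = schwartz_borel_measurable[OF assms(1)]
    show "integrable lborel (\<lambda>z. indicat_real {(a - r) / \<epsilon>..} z *\<^sub>R (\<eta> z / (r + \<epsilon> * z) ^ n))"
    proof (rule Bochner_Integration.integrable_bound)
      show "integrable lborel (\<lambda>z. norm (\<eta> z) / a ^ n)"
        using schwartz_integrable[OF assms(1)] by simp
      show "AE z in lborel. norm (indicat_real {(a - r) / \<epsilon>..} z *\<^sub>R (\<eta> z / (r + \<epsilon> * z) ^ n))
          \<le> norm (norm (\<eta> z) / a ^ n)"
        using bound assms by (intro AE_I2) simp
    qed measurable
  qed
  then show ?thesis by simp
qed

text \<open>Both the domain and the integrand depend on \<open>r\<close>. With the cut-off moved
  into the integrand, that integrand is jointly measurable in \<open>r\<close> and \<open>z\<close>,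
  and integrating out \<open>z\<close> preserves measurability.\<close>

lemma borel_measurable_Ups:
  assumes "schwartz \<eta>"
  shows "Ups \<eta> a \<epsilon> n \<in> borel_measurable borel"
proof -
  note [measurable] = schwartz_borel_measurable[OF assms]
  have "(\<lambda>r. LBINT z. (if (a - r) / \<epsilon> \<le> z then \<eta> z / (r + \<epsilon> * z) ^ n else 0)) \<in> borel_measurable borel"
    by measurable
  also have "(\<lambda>r. LBINT z. (if (a - r) / \<epsilon> \<le> z then \<eta> z / (r + \<epsilon> * z) ^ n else 0)) = Ups \<eta> a \<epsilon> n"
    by (auto simp: Ups_def set_lebesgue_integral_def fun_eq_iff indicator_def intro!: Bochner_Integration.integral_cong)
  finally show ?thesis .
qed

section \<open>Integrability criterion and vector ingredients of the force density\<close>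

lemma integrable_lborel_decay:
  fixes F :: "'a::euclidean_space \<Rightarrow> 'b::{banach, second_countable_topology}"
  assumes "F \<in> borel_measurable borel"
    and "\<And>x. norm (F x) \<le> C / (1 + (norm x)\<^sup>2) ^ DIM('a)"
  shows "integrable lborel F"
proof (rule Bochner_Integration.integrable_bound)
  show "integrable lborel (\<lambda>x::'a. C * (1 / (1 + (norm x)\<^sup>2) ^ DIM('a)))"
    by (intro integrable_mult_right integrable_lborel_norm_decay)
  show "AE x in lborel. norm (F x) \<le> norm (C * (1 / (1 + (norm x)\<^sup>2) ^ DIM('a)))"
  proof (intro AE_I2)
    fix x
    show "norm (F x) \<le> norm (C * (1 / (1 + (norm x)\<^sup>2) ^ DIM('a)))"
      \<comment> \<open>The sign of \<open>C\<close> is not fixed in advance, so the bound passes to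
        its absolute value.\<close>
      using order_trans[OF assms(2) abs_ge_self] by (simp only: real_norm_def mult_1_right times_divide_eq_right)
  qed
qed (use assms in simp)

lemma borel_measurable_cross3 [measurable (raw)]:
  assumes "f \<in> borel_measurable M" "g \<in> borel_measurable M"
  shows "(\<lambda>x. cross3 (f x) (g x)) \<in> borel_measurable M"
  using assms
  by (rule borel_measurable_continuous_Pair) (intro continuous_on_cross continuous_intros)

text \<open>An inequality, because the value at the origin is 0.\<close>

lemma norm_unit_vec_le: "norm (unit_vec r) \<le> 1"
  by (cases "r = 0") (simp_all add: unit_vec_def)

lemma unit_vec_minus: "unit_vec (- r) = - unit_vec r"
  by (simp add: unit_vec_def)

section \<open>Convergence and vanishing of the force integral\<close>

theorem mainTheorem3:
  fixes \<eta> :: "real \<Rightarrow> real" and e c :: real and \<mu> :: "real ^ 3"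
  assumes "mollifier \<eta>" and "c > 0"
  shows "\<forall>a\<in>{0<..<1}. \<forall>\<epsilon>\<in>{0<..<1}.
    integrable lborel
      (\<lambda>r. charge_density \<eta> a \<epsilon> e r *\<^sub>R E_field \<eta> a \<epsilon> e r
           + cross3 (current_density \<eta> a \<epsilon> c \<mu> r) (H_field \<eta> a \<epsilon> \<mu> r)) \<and>
    (LBINT r. charge_density \<eta> a \<epsilon> e r *\<^sub>R E_field \<eta> a \<epsilon> e r
           + cross3 (current_density \<eta> a \<epsilon> c \<mu> r) (H_field \<eta> a \<epsilon> \<mu> r)) = 0"
proof (intro ballI conjI)
  fix a \<epsilon> :: real
  assume "a \<in> {0<..<1}" "\<epsilon> \<in> {0<..<1}"
  then have a: "a > 0" and \<epsilon>: "\<epsilon> > 0" by auto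
  have \<eta>: "schwartz \<eta>" using assms(1) by (simp add: mollifier_def)
  note [measurable] = schwartz_borel_measurable[OF \<eta>] borel_measurable_Ups[OF \<eta>]
  let ?F = "\<lambda>r. charge_density \<eta> a \<epsilon> e r *\<^sub>R E_field \<eta> a \<epsilon> e r
           + cross3 (current_density \<eta> a \<epsilon> c \<mu> r) (H_field \<eta> a \<epsilon> \<mu> r)"
  have F_meas: "?F \<in> borel_measurable borel"
    unfolding charge_density_def E_field_def current_density_def H_field_def Ups'_def Ups''_def unit_vec_def
    by measurable
  \<comment> \<open>Valid at every point, the origin included, since \<open>unit_vec\<close> is 0
    there.\<close>
  have F_odd: "?F (- r) = - ?F r" for r
    by (simp add: charge_density_def E_field_def current_density_def H_field_def unit_vec_minus)

  \<comment> \<open>The exponent 3 is the dimension of the space, as the integrability criterion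
    requires.\<close>
  obtain C0 where C0: "\<And>t. \<bar>\<eta> ((a - t) / \<epsilon>)\<bar> \<le> C0 / (1 + t\<^sup>2) ^ 3"
    using bounded_moments_decay_affine[OF schwartz_moments(1)[OF \<eta>]] \<epsilon> by (metis less_irrefl)
  obtain C1 where C1: "\<And>t. \<bar>deriv \<eta> ((a - t) / \<epsilon>)\<bar> \<le> C1 / (1 + t\<^sup>2) ^ 3"
    using bounded_moments_decay_affine[OF schwartz_moments(2)[OF \<eta>]] \<epsilon> by (metis less_irrefl)
  have Ups': "\<exists>K. \<forall>t. \<bar>Ups' \<eta> a \<epsilon> n t\<bar> \<le> K / (1 + t\<^sup>2) ^ 3" for n
  proof (intro exI allI)
    fix t
    show "\<bar>Ups' \<eta> a \<epsilon> n t\<bar> \<le> (1 / (a ^ n * \<epsilon>) * C0) / (1 + t\<^sup>2) ^ 3"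
      using mult_left_mono[OF C0[of t], of "1 / (a ^ n * \<epsilon>)"] a \<epsilon> by (simp add: Ups'_def abs_mult)
  qed
  have Ups'': "\<exists>K. \<forall>t. \<bar>Ups'' \<eta> a \<epsilon> n t\<bar> \<le> K / (1 + t\<^sup>2) ^ 3" for n
  proof (intro exI allI)
    fix t
    have "\<bar>Ups'' \<eta> a \<epsilon> n t\<bar> \<le> 1 / (a ^ n * \<epsilon>\<^sup>2) * \<bar>deriv \<eta> ((a - t) / \<epsilon>)\<bar>
        + real n / (a ^ (n + 1) * \<epsilon>) * \<bar>\<eta> ((a - t) / \<epsilon>)\<bar>"
      unfolding Ups''_def using a \<epsilon> by (intro order_trans[OF abs_triangle_ineq]) (simp add: abs_mult)
    also have "\<dots> \<le> 1 / (a ^ n * \<epsilon>\<^sup>2) * (C1 / (1 + t\<^sup>2) ^ 3)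
        + real n / (a ^ (n + 1) * \<epsilon>) * (C0 / (1 + t\<^sup>2) ^ 3)"
      using a \<epsilon> by (intro add_mono mult_left_mono C0 C1) auto
    also have "\<dots> = (1 / (a ^ n * \<epsilon>\<^sup>2) * C1 + real n / (a ^ (n + 1) * \<epsilon>) * C0) / (1 + t\<^sup>2) ^ 3"
      by (simp add: add_divide_distrib)
    finally show "\<bar>Ups'' \<eta> a \<epsilon> n t\<bar> \<le> \<dots>" .
  qed
  \<comment> \<open>Evaluation at 0 gives \<open>K \<ge> 0\<close>, so \<open>K\<close> itself
    bounds \<open>f\<close>.\<close>
  have decay_bounded: "\<exists>M. \<forall>t. \<bar>f t\<bar> \<le> M" if "\<exists>K. \<forall>t. \<bar>f t\<bar> \<le> K / (1 + t\<^sup>2) ^ 3"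
    for f :: "real \<Rightarrow> real"
  proof -
    from that obtain K where K: "\<And>t. \<bar>f t\<bar> \<le> K / (1 + t\<^sup>2) ^ 3" by blast
    have "0 \<le> K" using K[of 0] by simp
    have "K / (1 + t\<^sup>2) ^ 3 \<le> K / 1" for t :: real
      using \<open>0 \<le> K\<close> by (intro divide_left_mono one_le_power) (auto intro: add_pos_nonneg)
    then show ?thesis using K by (intro exI[of _ K]) (metis div_by_1 order_trans)
  qed
  let ?N = "LBINT z. \<bar>\<eta> z\<bar>"
  \<comment> \<open>The terms in the fields only need to be bounded (\<open>M1\<close>,
    \<open>M2\<close>); those in the charge and current densities must decay (\<open>K1\<close>,
    \<open>K2\<close>, \<open>K3\<close>).\<close>
  obtain M1 where M1: "\<And>t. \<bar>Ups' \<eta> a \<epsilon> 1 t\<bar> \<le> M1" using decay_bounded[OF Ups'] by blast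
  obtain M2 where M2: "\<And>t. \<bar>Ups' \<eta> a \<epsilon> 2 t\<bar> \<le> M2" using decay_bounded[OF Ups'] by blast
  obtain K3 where K3: "\<And>t. \<bar>Ups' \<eta> a \<epsilon> 3 t\<bar> \<le> K3 / (1 + t\<^sup>2) ^ 3" using Ups' by blast
  obtain K1 where K1: "\<And>t. \<bar>Ups'' \<eta> a \<epsilon> 1 t\<bar> \<le> K1 / (1 + t\<^sup>2) ^ 3" using Ups'' by blast
  obtain K2 where K2: "\<And>t. \<bar>Ups'' \<eta> a \<epsilon> 2 t\<bar> \<le> K2 / (1 + t\<^sup>2) ^ 3" using Ups'' by blast

  \<comment> \<open>\<open>BE\<close> and \<open>BH\<close> bound the fields, \<open>B\<rho>\<close>
    and \<open>Bj\<close> are the decay constants of the sources. In \<open>BH\<close> the factors 4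
    = 3 + 1 and 2 = 1 + 1 come from the triangle inequality in the two brackets of the magnetic
    field.\<close>
  define BE where "BE = \<bar>e\<bar> * (?N / a ^ 2 + M1)"
  define BH where "BH = ?N / a ^ 3 * (4 * norm \<mu>) + M2 * (2 * norm \<mu>)"
  define B\<rho> where "B\<rho> = \<bar>e\<bar> / (4 * pi) * K1"
  define Bj where "Bj = \<bar>c\<bar> / (4 * pi) * (2 * K3 + K2) * norm \<mu>"

  have inner_le: "\<bar>\<mu> \<bullet> unit_vec r\<bar> * norm (unit_vec r) \<le> norm \<mu>" for r
  proof -
    have "\<bar>\<mu> \<bullet> unit_vec r\<bar> * norm (unit_vec r) \<le> (norm \<mu> * norm (unit_vec r)) * norm (unit_vec r)"
      by (intro mult_right_mono Cauchy_Schwarz_ineq2) auto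
    also have "\<dots> \<le> norm \<mu> * 1 * 1"
      by (intro mult_mono norm_unit_vec_le) auto
    finally show ?thesis by simp
  qed
  have E_bound: "norm (E_field \<eta> a \<epsilon> e r) \<le> BE" for r
  proof -
    have U: "\<bar>Ups \<eta> a \<epsilon> 2 (norm r) - Ups' \<eta> a \<epsilon> 1 (norm r)\<bar> \<le> ?N / a ^ 2 + M1"
      using abs_Ups_le[OF \<eta> a \<epsilon>, of 2 "norm r"] M1[of "norm r"] by linarith
    \<comment> \<open>Multiplying the estimates requires the upper bounds to be nonnegative; this
      follows from the estimates themselves, as each dominates an absolute value. The same device
      serves for the other products below.\<close>
    have "norm (E_field \<eta> a \<epsilon> e r) \<le> (\<bar>e\<bar> * (?N / a ^ 2 + M1)) * 1"
      unfolding E_field_def norm_scaleR abs_mult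
      by (intro mult_mono mult_left_mono U norm_unit_vec_le mult_nonneg_nonneg
            order_trans[OF abs_ge_zero U] abs_ge_zero norm_ge_zero)
    then show ?thesis by (simp add: BE_def)
  qed
  have H_bound: "norm (H_field \<eta> a \<epsilon> \<mu> r) \<le> BH" for r
  proof -
    have 1: "norm ((3 * (\<mu> \<bullet> unit_vec r)) *\<^sub>R unit_vec r - \<mu>) \<le> 4 * norm \<mu>"
      using inner_le[of r] by (intro order_trans[OF norm_triangle_ineq4]) (simp add: abs_mult)
    have 2: "norm ((\<mu> \<bullet> unit_vec r) *\<^sub>R unit_vec r - \<mu>) \<le> 2 * norm \<mu>"
      using inner_le[of r] by (intro order_trans[OF norm_triangle_ineq4]) (simp add: abs_mult)
    show ?thesis
      unfolding H_field_def BH_def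
      by (rule order_trans[OF norm_triangle_ineq4], unfold norm_scaleR)
         (intro add_mono mult_mono 1 2 abs_Ups_le[OF \<eta> a \<epsilon>] M2 norm_ge_zero
            order_trans[OF abs_ge_zero M2] order_trans[OF abs_ge_zero abs_Ups_le[OF \<eta> a \<epsilon>]])
  qed
  have \<rho>_bound: "\<bar>charge_density \<eta> a \<epsilon> e r\<bar> \<le> B\<rho> / (1 + (norm r)\<^sup>2) ^ 3" for r
    using mult_left_mono[OF K1[of "norm r"], of "\<bar>e\<bar> / (4 * pi)"]
    by (simp add: charge_density_def abs_mult B\<rho>_def)
  have j_bound: "norm (current_density \<eta> a \<epsilon> c \<mu> r) \<le> Bj / (1 + (norm r)\<^sup>2) ^ 3" for r
  proof -
    have U: "\<bar>2 * Ups' \<eta> a \<epsilon> 3 (norm r) - Ups'' \<eta> a \<epsilon> 2 (norm r)\<bar>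
        \<le> 2 * (K3 / (1 + (norm r)\<^sup>2) ^ 3) + K2 / (1 + (norm r)\<^sup>2) ^ 3"
      using K3[of "norm r"] K2[of "norm r"] by linarith
    have X: "norm (cross3 \<mu> (unit_vec r)) \<le> norm \<mu> * 1"
      by (intro order_trans[OF norm_cross3_le] mult_left_mono norm_unit_vec_le) auto
    have "norm (current_density \<eta> a \<epsilon> c \<mu> r)
        \<le> \<bar>c / (4 * pi)\<bar> * (2 * (K3 / (1 + (norm r)\<^sup>2) ^ 3) + K2 / (1 + (norm r)\<^sup>2) ^ 3) * (norm \<mu> * 1)"
      unfolding current_density_def norm_scaleR abs_mult
      by (intro mult_mono mult_left_mono mult_nonneg_nonneg U X order_trans[OF abs_ge_zero U]
            abs_ge_zero norm_ge_zero)
    also have "\<dots> = Bj / (1 + (norm r)\<^sup>2) ^ 3"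
      by (simp add: Bj_def algebra_simps add_divide_distrib)
    finally show ?thesis .
  qed
  \<comment> \<open>Each term of the force density is a decaying source times a bounded
    field.\<close>
  have "norm (?F r) \<le> (B\<rho> * BE + Bj * BH) / (1 + (norm r)\<^sup>2) ^ DIM(real ^ 3)" for r
  proof -
    have "norm (?F r) \<le> \<bar>charge_density \<eta> a \<epsilon> e r\<bar> * norm (E_field \<eta> a \<epsilon> e r)
        + norm (current_density \<eta> a \<epsilon> c \<mu> r) * norm (H_field \<eta> a \<epsilon> \<mu> r)"
      using norm_cross3_le by (intro order_trans[OF norm_triangle_ineq]) (simp add: add_mono)
    also have "\<dots> \<le> B\<rho> / (1 + (norm r)\<^sup>2) ^ 3 * BE + Bj / (1 + (norm r)\<^sup>2) ^ 3 * BH"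
      by (intro add_mono mult_mono \<rho>_bound E_bound j_bound H_bound norm_ge_zero
            order_trans[OF abs_ge_zero \<rho>_bound] order_trans[OF norm_ge_zero j_bound])
    finally show ?thesis by (simp add: add_divide_distrib)
  qed
  then show "integrable lborel ?F"
    by (rule integrable_lborel_decay[OF F_meas])
  show "(LBINT r. ?F r) = 0"
    by (rule lborel_integral_odd_eq_0[OF F_meas F_odd])
qed

end
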